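(* Let $m\ge 3$ be odd, and let $C_{1,3}^{\perp}$ be the dual of the primitive cyclic BCH code $C_{1,3}$ of length $2^m-1$. Then $C_{1,3}^{\perp}$ consists of one $i$-component for every coordinate position $i$.
   Context: $C_{1,3}$ is the binary primitive cyclic BCH code (designed distance 5) of length $2^m-1$ with zeros $\alpha$ and $\alpha^3$, where $\alpha$ is a primitive element of the Galois field $GF(2^m)$. $C_{1,3}^\perp$ is its dual (orthogonal) binary linear code. $i$-component: for a binary code $C$ with minimum distance $\delta$ (the smallest Hamming distance between two different codewords) and a coordinate position $i$, let $G_i(C)$ be the graph whose vertices are the codewords of $C$ and whose edges are the pairs $(x,y)$ of codewords at Hamming distance $d(x,y)=\delta$ with $x_i\ne y_i$. A connected component of $G_i(C)$ is called an $i$-component of $C$. *)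

theory Defs
  imports
    "HOL-Library.Z2"
    "HOL-Library.Cardinality"
    "Jordan_Normal_Form.Matrix"
    "Graph_Theory.Graph_Theory"
begin

text \<open>A binary word of length \<open>n\<close> is an element of \<open>carrier_vec n :: bit vec set\<close>; its coordinate
  positions are \<open>0, ..., n - 1\<close>.\<close>

definition hamming_dist :: "bit vec \<Rightarrow> bit vec \<Rightarrow> nat" where
  "hamming_dist x y = card {j. j < dim_vec x \<and> x $ j \<noteq> y $ j}"

text \<open>\<open>Inf\<close> on \<open>nat\<close> is the least element of a nonempty set; codes with fewer than two codewords
  get the junk value \<open>0\<close>.\<close>

definition min_dist :: "bit vec set \<Rightarrow> nat" where
  "min_dist C = Inf {hamming_dist x y | x y. x \<in> C \<and> y \<in> C \<and> x \<noteq> y}"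

definition dual_code :: "nat \<Rightarrow> bit vec set \<Rightarrow> bit vec set" where
  "dual_code n C = {x \<in> carrier_vec n. \<forall>c\<in>C. x \<bullet> c = 0}"

definition primitive_element :: "'a::field \<Rightarrow> bool" where
  "primitive_element \<alpha> \<longleftrightarrow> range (\<lambda>k::nat. \<alpha> ^ k) = UNIV - {0}"

text \<open>Value at \<open>\<beta>\<close> of the code polynomial \<open>c\<^sub>0 + c\<^sub>1 X + ... + c\<^bsub>n-1\<^esub> X^(n-1)\<close>. The \<open>of_bool\<close> factor embeds
  \<open>GF(2)\<close> into \<open>'a\<close>; this is a field embedding when \<open>'a\<close> has characteristic 2.\<close>

definition code_poly_eval :: "bit vec \<Rightarrow> 'a::field \<Rightarrow> 'a" where
  "code_poly_eval c \<beta> = (\<Sum>j<dim_vec c. of_bool (c $ j = 1) * \<beta> ^ j)"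

definition cyclic_code :: "nat \<Rightarrow> 'a::field set \<Rightarrow> bit vec set" where
  "cyclic_code n Z = {c \<in> carrier_vec n. \<forall>\<beta>\<in>Z. code_poly_eval c \<beta> = 0}"

definition bch_code_13 :: "nat \<Rightarrow> 'a::field \<Rightarrow> bit vec set" where
  "bch_code_13 m \<alpha> = cyclic_code (2 ^ m - 1) {\<alpha>, \<alpha> ^ 3}"

definition i_graph :: "bit vec set \<Rightarrow> nat \<Rightarrow> bit vec pair_pre_digraph" where
  "i_graph C i = \<lparr> pverts = C,
     parcs = {(x, y). x \<in> C \<and> y \<in> C \<and> hamming_dist x y = min_dist C \<and> x $ i \<noteq> y $ i} \<rparr>"

text \<open>The undirected graph is encoded by its symmetric digraph (see \<open>symmetric_i_graph\<close> below), so
  connected components are strongly connected components. They are given by their vertex sets.\<close>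

definition i_components :: "bit vec set \<Rightarrow> nat \<Rightarrow> bit vec set set" where
  "i_components C i = pre_digraph.sccs_verts (with_proj (i_graph C i))"

lemma symmetric_i_graph:
  assumes "C \<subseteq> carrier_vec n"
  shows "symmetric (with_proj (i_graph C i))"
proof -
  have "hamming_dist x y = hamming_dist y x" if "x \<in> C" "y \<in> C" for x y
  proof -
    have "dim_vec x = dim_vec y" using that assms by (metis carrier_vecD subsetD)
    then show ?thesis by (simp add: hamming_dist_def eq_commute)
  qed
  then show ?thesis
    by (auto simp: symmetric_def i_graph_def arcs_ends_def arc_to_ends_def intro!: symI)
qed

end

theory Submission
  imports Defs "HOL-Computational_Algebra.Polynomial"
begin

text \<open>The words of the dual code are \<open>(Tr (a x + b x\<^sup>3))\<^sub>x\<close> with \<open>x\<close> ranging over the nonzero field elements,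
  and their weights are governed by the exponential sums \<open>W(a, b) = \<Sum>\<^sub>x (-1)^Tr (a x + b x\<^sup>3)\<close>, which for
  odd \<open>m\<close> and \<open>(a, b) \<noteq> (0, 0)\<close> take only the values \<open>0\<close> and \<open>\<plusminus>s\<close>, where \<open>s\<^sup>2 = 2\<^bsup>m+1\<^esup>\<close>. Minimum weight
  words are those with \<open>W = s\<close>. The graph is a Cayley graph of the dual code, so it is connected iff
  the minimum weight words that are nonzero at position \<open>i\<close>, i.e. at \<open>t = \<alpha>\<^sup>i\<close>, generate the code. If they did
  not, a nonzero functional \<open>Tr (a u + b v)\<close> would vanish on all of them, and then
  \<open>(W\<^sup>2 + s W) (1 - (-1)^Tr (a t + b t\<^sup>3)) (1 - (-1)^Tr (a u + b v))\<close> would vanish for all \<open>a, b\<close>. But the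
  sum of these terms is \<open>4\<^sup>m\<close> times a combination of numbers of solutions of \<open>x + y = U\<close>, \<open>x\<^sup>3 + y\<^sup>3 = V\<close>,
  and that combination is positive.\<close>

text \<open>These rules rewrite \<open>+\<close> and \<open>*\<close> on \<open>bit\<close> to \<open>xor\<close> and \<open>and\<close>, out of reach of the ring lemmas.\<close>
declare add_bit_eq_xor [simp del] mult_bit_eq_and [simp del]

section \<open>Signs of bits and orthogonality of binary words\<close>

definition bit_sign :: "bit \<Rightarrow> int" where
  "bit_sign b = (if b = 0 then 1 else - 1)"

lemma bit_sign_simps [simp]: "bit_sign 0 = 1" "bit_sign 1 = - 1"
  by (simp_all add: bit_sign_def)

lemma bit_add_self [simp]: "b + b = (0::bit)"
  by (cases b) simp_all

lemma bit_sign_add: "bit_sign (a + b) = bit_sign a * bit_sign b"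
  by (cases a; cases b) simp_all

text \<open>Reindexing along \<open>t\<close> makes the sum its own negative. The orthogonality
  relations below all come from this, with \<open>t\<close> a translation.\<close>

lemma sum_eq_zero_translation:
  fixes f :: "'a \<Rightarrow> int"
  assumes "bij_betw t A A" "\<And>x. x \<in> A \<Longrightarrow> f (t x) = - f x"
  shows "sum f A = 0"
proof -
  have "sum f A = (\<Sum>x\<in>A. f (t x))"
    using assms(1) by (simp add: sum.reindex_bij_betw)
  also have "\<dots> = - sum f A"
    using assms(2) by (simp add: sum_negf)
  finally show ?thesis by simp
qed

lemma bit_vec_add_self: "x \<in> carrier_vec n \<Longrightarrow> x + x = (0\<^sub>v n :: bit vec)"
  by (intro eq_vecI) auto

lemma bit_vec_add_cancel:
  fixes x y :: "bit vec"
  assumes "x \<in> carrier_vec n" "y \<in> carrier_vec n"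
  shows "x + y + y = x"
  using assms by (simp add: assoc_add_vec[of x n] bit_vec_add_self)

lemma finite_bit_UNIV: "finite (UNIV :: bit set)"
proof -
  have "(UNIV :: bit set) = {0, 1}" by auto
  then show ?thesis by (metis finite.simps)
qed

lemma finite_carrier_bit_vec: "finite (carrier_vec n :: bit vec set)"
proof -
  have "carrier_vec n \<subseteq> vec_of_list ` {xs :: bit list. set xs \<subseteq> UNIV \<and> length xs = n}"
  proof
    fix x :: "bit vec" assume "x \<in> carrier_vec n"
    then have "x = vec_of_list (list_of_vec x)" "length (list_of_vec x) = n"
      by (auto simp: vec_list)
    then show "x \<in> vec_of_list ` {xs. set xs \<subseteq> UNIV \<and> length xs = n}" by blast
  qed
  then show ?thesis
    by (rule finite_subset) (intro finite_imageI finite_lists_length_eq finite_bit_UNIV)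
qed

lemma bij_betw_translation:
  fixes S :: "bit vec set"
  assumes "S \<subseteq> carrier_vec n" "\<And>x y. x \<in> S \<Longrightarrow> y \<in> S \<Longrightarrow> x + y \<in> S" "t \<in> S"
  shows "bij_betw (\<lambda>x. x + t) S S"
  using assms
  by (intro bij_betw_byWitness[where f' = "\<lambda>x. x + t"])
    (auto simp del: add_carrier_vec intro: bit_vec_add_cancel[of _ n])

text \<open>By orthogonality, the sum of \<open>(\<Sum>s\<in>S. (-1)^(c \<bullet> s)) * (1 - (-1)^(c \<bullet> w))\<close> over all words \<open>c\<close> is the
  number of words; a word \<open>c\<close> with a nonzero term separates \<open>w\<close> from \<open>S\<close>.\<close>
lemma separating_word:
  fixes S :: "bit vec set"
  assumes S: "S \<subseteq> carrier_vec n" "0\<^sub>v n \<in> S" "\<And>x y. x \<in> S \<Longrightarrow> y \<in> S \<Longrightarrow> x + y \<in> S"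
    and w: "w \<in> carrier_vec n" "w \<notin> S"
  shows "\<exists>c\<in>carrier_vec n. (\<forall>s\<in>S. c \<bullet> s = 0) \<and> c \<bullet> w = 1"
proof (rule ccontr)
  assume no: "\<not> ?thesis"
  let ?V = "carrier_vec n :: bit vec set"
  define e where "e c s = bit_sign (c \<bullet> s)" for c s :: "bit vec"
  have e_add_right: "e c (s + t) = e c s * e c t" if "c \<in> ?V" "s \<in> ?V" "t \<in> ?V" for c s t
    using that by (simp add: e_def scalar_prod_add_distrib[of c n] bit_sign_add)
  have e_add_left: "e (c + d) s = e c s * e d s" if "c \<in> ?V" "d \<in> ?V" "s \<in> ?V" for c d s
    using that by (simp add: e_def add_scalar_prod_distrib[of c n] bit_sign_add)
  have "(\<Sum>s\<in>S. e c s) * (1 - e c w) = 0" if c: "c \<in> ?V" for c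
  proof (cases "\<forall>s\<in>S. c \<bullet> s = 0")
    case True
    then have "c \<bullet> w = 0" using no c by auto
    then show ?thesis by (simp add: e_def)
  next
    case False
    then obtain t where t: "t \<in> S" "c \<bullet> t = 1" by auto
    have "(\<Sum>s\<in>S. e c s) = 0"
    proof (rule sum_eq_zero_translation)
      show "bij_betw (\<lambda>x. x + t) S S" using S t by (intro bij_betw_translation)
      show "e c (s + t) = - e c s" if "s \<in> S" for s
        using that e_add_right[OF c, of s t] S(1) t by (auto simp: e_def)
    qed
    then show ?thesis by simp
  qed
  then have "0 = (\<Sum>c\<in>?V. (\<Sum>s\<in>S. e c s) * (1 - e c w))"
    by (intro sum.neutral[symmetric] ballI)
  also have "\<dots> = (\<Sum>c\<in>?V. \<Sum>s\<in>S. e c s - e c (s + w))"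
    unfolding sum_distrib_right
    using S(1) w by (intro sum.cong refl) (auto simp: e_add_right algebra_simps subset_iff)
  also have "\<dots> = (\<Sum>s\<in>S. \<Sum>c\<in>?V. e c s - e c (s + w))"
    by (rule sum.swap)
  also have "\<dots> = (\<Sum>s\<in>S. if s = 0\<^sub>v n then int (card ?V) else 0)"
  proof (rule sum.cong)
    have orth: "(\<Sum>c\<in>?V. e c v) = 0" if v: "v \<in> ?V" "v \<noteq> 0\<^sub>v n" for v
    proof -
      obtain j where j: "j < n" "v $ j = 1"
        using v by (metis bit_not_one_iff carrier_vecD eq_vecI index_zero_vec(1) index_zero_vec(2))
      show ?thesis
      proof (rule sum_eq_zero_translation)
        show "bij_betw (\<lambda>x. x + unit_vec n j) ?V ?V"
          by (intro bij_betw_translation) auto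
        show "e (x + unit_vec n j) v = - e x v" if "x \<in> ?V" for x
          using that v j by (simp add: e_add_left) (simp add: e_def)
      qed
    qed
    fix s assume s: "s \<in> S"
    have "s + w \<noteq> 0\<^sub>v n"
      using s w S(1) bit_vec_add_cancel[of s n w] by (metis left_zero_vec subset_iff)
    then have "(\<Sum>c\<in>?V. e c (s + w)) = 0"
      using s w S(1) by (intro orth) auto
    moreover have "(\<Sum>c\<in>?V. e c (0\<^sub>v n)) = int (card ?V)"
      by (simp add: e_def)
    ultimately show "(\<Sum>c\<in>?V. e c s - e c (s + w)) = (if s = 0\<^sub>v n then int (card ?V) else 0)"
      using s S(1) orth by (auto simp: sum_subtractf)
  qed simp
  also have "\<dots> = int (card ?V)"
    using S(1,2) finite_carrier_bit_vec[of n] by (simp add: finite_subset)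
  also have "\<dots> > 0"
    using finite_carrier_bit_vec[of n] w(1) by (auto simp: card_gt_0_iff)
  finally show False by simp
qed

text \<open>Holds in every commutative ring, so expansion proves it; the multiple of 2 disappears in
  characteristic 2. The next identity is built the same way.\<close>

lemma shifted_cube_identity:
  fixes a b x w :: "'a::comm_ring_1"
  shows "(a * x + b * x ^ 3) + (a * (x + w) + b * (x + w) ^ 3)
    = (a * w + b * w ^ 3) + b * w * x\<^sup>2 + b * w\<^sup>2 * x
      + 2 * (a * x + b * x ^ 3 + b * w * x\<^sup>2 + b * w\<^sup>2 * x)"
  by (simp add: algebra_simps numeral_eq_Suc)

lemma sum_cubes_identity:
  fixes x y :: "'a::comm_ring_1"
  shows "(x + y) ^ 3 + x * y * (x + y) = x ^ 3 + y ^ 3 + 2 * (2 * (x * y * (x + y)))"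
  by (simp add: algebra_simps numeral_eq_Suc)

section \<open>The field with 2^m elements\<close>

locale binary_bch =
  fixes \<alpha> :: "'a::{field,finite}" and m :: nat
  assumes card_field: "CARD('a) = 2 ^ m"
    and m_ge: "m \<ge> 3"
    and odd_m: "odd m"
    and primitive: "primitive_element \<alpha>"
begin

text \<open>The shift by 1 permutes the field, so comparing sums gives 2^m = 0 in the field, which
  has no zero divisors.\<close>

lemma two_eq_zero: "(2::'a) = 0"
proof -
  have "(\<Sum>x::'a\<in>UNIV. x + 1) = (\<Sum>x\<in>UNIV. x)"
    by (rule sum.reindex_bij_betw) (rule bij_betw_byWitness[where f' = "\<lambda>x. x - 1"], auto)
  then have "of_nat CARD('a) = (0::'a)" by (simp add: sum.distrib)
  then show ?thesis by (simp add: card_field)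
qed

lemma add_self [simp]: "x + x = (0::'a)"
  using two_eq_zero by (metis mult_2 mult_zero_left)

lemma uminus_eq [simp]: "- x = (x::'a)"
  by (metis add_self minus_unique)

lemma add_eq_zero_iff: "x + y = 0 \<longleftrightarrow> x = (y::'a)"
  by (metis add_eq_0_iff uminus_eq)

lemma square_add: "(x + y)\<^sup>2 = x\<^sup>2 + (y::'a)\<^sup>2"
  by (simp add: power2_sum two_eq_zero)

lemma frobenius_add: "(x + y) ^ (2 ^ k) = x ^ (2 ^ k) + (y::'a) ^ (2 ^ k)"
  by (induction k) (simp_all add: power_mult square_add mult.commute[of 2])

text \<open>Multiplication by \<open>x\<close> permutes the nonzero elements and hence preserves
  their product.\<close>

lemma power_card_minus_one:
  assumes "x \<noteq> 0"
  shows "x ^ (2 ^ m - 1) = (1::'a)"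
proof -
  have "bij_betw ((*) x) (UNIV - {0}) (UNIV - {0})"
    using assms by (intro bij_betw_byWitness[where f' = "\<lambda>y. y / x"]) auto
  then have "(\<Prod>y\<in>UNIV - {0}. x * y) = \<Prod>(UNIV - {0})"
    by (rule prod.reindex_bij_betw)
  then have "x ^ card (UNIV - {0 :: 'a}) * \<Prod>(UNIV - {0}) = \<Prod>(UNIV - {0})"
    by (simp add: prod.distrib)
  moreover have "card (UNIV - {0 :: 'a}) = 2 ^ m - 1"
    by (simp add: card_Diff_singleton card_field)
  ultimately show ?thesis by simp
qed

lemma power_card [simp]: "x ^ (2 ^ m) = (x::'a)"
  using power_card_minus_one[of x] power_minus_mult[of "2 ^ m" x] by (cases "x = 0") simp_all

section \<open>The absolute trace and the additive character built from it\<close>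

definition field_trace :: "'a \<Rightarrow> 'a" where
  "field_trace x = (\<Sum>k<m. x ^ (2 ^ k))"

lemma field_trace_add: "field_trace (x + y) = field_trace x + field_trace y"
  by (simp add: field_trace_def frobenius_add sum.distrib)

lemma field_trace_square: "field_trace (x\<^sup>2) = field_trace x"
proof -
  \<comment> \<open>Squaring shifts the exponents by one place. Adding x completes both traces to
    the same sum over k \<le> m, because x^(2^m) = x.\<close>
  have "field_trace (x\<^sup>2) + x = (\<Sum>k<m. x ^ (2 ^ Suc k)) + x ^ (2 ^ 0)"
    by (simp add: field_trace_def flip: power_mult)
  also have "\<dots> = (\<Sum>k<Suc m. x ^ (2 ^ k))"
    by (subst sum.lessThan_Suc_shift) (simp add: add.commute)
  also have "\<dots> = field_trace x + x"
    by (simp add: field_trace_def)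
  finally show ?thesis by simp
qed

text \<open>The trace equals its own square, and a field has no idempotents besides 0 and 1.\<close>

lemma field_trace_cases: "field_trace x = 0 \<or> field_trace x = 1"
proof -
  have "(\<Sum>k<j. x ^ (2 ^ k))\<^sup>2 = (\<Sum>k<j. (x\<^sup>2) ^ (2 ^ k))" for j
    by (induction j) (simp_all add: square_add flip: power_mult, simp add: mult.commute)
  then have "(field_trace x)\<^sup>2 = field_trace x"
    using field_trace_square[of x] by (simp add: field_trace_def)
  then show ?thesis by (simp add: power2_eq_square)
qed

text \<open>As a polynomial the trace is nonzero of degree at most 2^(m-1), too small to vanish at
  all 2^m field elements.\<close>

lemma field_trace_nonzero: "\<exists>x. field_trace x \<noteq> 0"
proof (rule ccontr)
  assume zero: "\<nexists>x. field_trace x \<noteq> 0"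
  define p :: "'a poly" where "p = (\<Sum>k<m. monom 1 (2 ^ k))"
  have eval: "poly p x = field_trace x" for x
    by (simp add: p_def field_trace_def poly_sum poly_monom)
  have "coeff p 1 = (\<Sum>k<m. if k = 0 then 1 else 0)"
    unfolding p_def coeff_sum by (intro sum.cong) auto
  also have "\<dots> = 1" using m_ge by simp
  finally have "p \<noteq> 0" by auto
  then have "CARD('a) \<le> degree p"
    using card_poly_roots_bound[OF \<open>p \<noteq> 0\<close>] zero eval by simp
  moreover have "degree p \<le> 2 ^ (m - 1)"
    unfolding p_def
    by (intro degree_sum_le) (auto intro!: order.trans[OF degree_monom_le] power_increasing)
  moreover have "(2::nat) ^ (m - 1) < 2 ^ m" using m_ge by simp
  ultimately show False by (simp add: card_field)
qed

definition tr :: "'a \<Rightarrow> bit" where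
  "tr x = (if field_trace x = 0 then 0 else 1)"

lemma tr_add: "tr (x + y) = tr x + tr y"
  using field_trace_cases[of x] field_trace_cases[of y]
  by (auto simp: tr_def field_trace_add)

lemma tr_zero [simp]: "tr 0 = 0"
  using tr_add[of 0 0] by simp

lemma tr_square: "tr (x\<^sup>2) = tr x"
  by (simp add: tr_def field_trace_square)

lemma tr_sum: "tr (sum f A) = (\<Sum>x\<in>A. tr (f x))"
  by (induction A rule: infinite_finite_induct) (simp_all add: tr_add)

lemma tr_nondegenerate:
  assumes "c \<noteq> 0"
  shows "\<exists>x. tr (c * x) = 1"
proof -
  obtain y where "field_trace y \<noteq> 0" using field_trace_nonzero by blast
  then have "tr (c * (y / c)) = 1" using assms by (simp add: tr_def)
  then show ?thesis by blast
qed

definition chi :: "'a \<Rightarrow> int" where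
  "chi x = bit_sign (tr x)"

lemma chi_add: "chi (x + y) = chi x * chi y"
  by (simp add: chi_def tr_add bit_sign_add)

lemma chi_zero [simp]: "chi 0 = 1"
  by (simp add: chi_def)

lemma chi_square: "chi (x\<^sup>2) = chi x"
  by (simp add: chi_def tr_square)

lemma chi_cases: "chi x = 1 \<or> chi x = - 1"
  by (simp add: chi_def bit_sign_def)

text \<open>For nonzero c, translation by some y with \<open>tr (c * y) = 1\<close> flips every
  sign.\<close>

lemma sum_chi: "(\<Sum>x\<in>UNIV. chi (c * x)) = (if c = 0 then 2 ^ m else 0)"
proof (cases "c = 0")
  case False
  then obtain y where "tr (c * y) = 1" using tr_nondegenerate by blast
  then have "chi (c * (x + y)) = - chi (c * x)" for x
    by (simp add: distrib_left chi_add) (simp add: chi_def)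
  moreover have "bij_betw (\<lambda>x. x + y) UNIV UNIV"
    by (rule bij_betw_byWitness[where f' = "\<lambda>x. x - y"]) auto
  ultimately show ?thesis
    using False sum_eq_zero_translation[where f = "\<lambda>x. chi (c * x)"] by metis
qed (simp add: card_field)


section \<open>Cubing and squaring as permutations of the field\<close>

lemma cube_surj: "\<exists>x. x ^ 3 = (y::'a)"
proof -
  obtain k where k: "m = 2 * k + 1" using odd_m oddE by blast
  \<comment> \<open>For odd m, 2^m = 3t + 2, so 3(2t + 1) = 2(2^m - 1) + 1 and the exponent 2t + 1
    extracts cube roots.\<close>
  have "2 ^ (2 * k + 1) mod 3 = (2::nat)"
  proof (induction k)
    case (Suc k)
    have "(2::nat) ^ (2 * Suc k + 1) mod 3 = 4 * (2 ^ (2 * k + 1) mod 3) mod 3"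
      by (simp add: mod_mult_right_eq)
    then show ?case using Suc by simp
  qed simp
  then have "2 ^ m = 3 * (2 ^ m div 3) + (2::nat)"
    using k by (metis mult_div_mod_eq)
  then obtain t where t: "2 ^ m = 3 * t + (2::nat)" by blast
  have "(y ^ (2 * t + 1)) ^ 3 = y ^ (2 ^ m + (2 ^ m - 1))"
  proof -
    have "2 ^ m + (2 ^ m - 1) = (2 * t + 1) * 3" using t by simp
    then show ?thesis by (metis power_mult)
  qed
  also have "\<dots> = y"
    unfolding power_add using power_card_minus_one[of y] by (cases "y = 0") simp_all
  finally show ?thesis by blast
qed

lemma cube_eq_iff: "x ^ 3 = y ^ 3 \<longleftrightarrow> x = (y::'a)"
proof -
  have "surj (\<lambda>x::'a. x ^ 3)" using cube_surj by (metis surj_def)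
  then have "inj (\<lambda>x::'a. x ^ 3)" by (rule finite_UNIV_surj_inj[OF finite])
  then show ?thesis by (auto dest: injD)
qed

lemma bij_square: "bij (\<lambda>x::'a. x\<^sup>2)"
proof -
  have "x = y" if "x\<^sup>2 = y\<^sup>2" for x y :: 'a
    using that by (metis add_eq_zero_iff square_add zero_eq_power2)
  then have "inj (\<lambda>x::'a. x\<^sup>2)" by (auto intro: injI)
  then show ?thesis using finite_UNIV_inj_surj[OF finite] by (auto simp: bij_def)
qed

section \<open>The exponential sums and their values\<close>

definition weil_sum :: "'a \<Rightarrow> 'a \<Rightarrow> int" where
  "weil_sum a b = (\<Sum>x\<in>UNIV. chi (a * x + b * x ^ 3))"

lemma weil_sum_square:
  "(weil_sum a b)\<^sup>2 = (\<Sum>p\<in>UNIV. chi (a * (fst p + snd p) + b * (fst p ^ 3 + snd p ^ 3)))"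
proof -
  have "(weil_sum a b)\<^sup>2 = (\<Sum>x\<in>UNIV. \<Sum>y\<in>UNIV. chi (a * (x + y) + b * (x ^ 3 + y ^ 3)))"
    unfolding weil_sum_def power2_eq_square sum_product
    by (intro sum.cong refl) (simp add: algebra_simps flip: chi_add)
  then show ?thesis
    by (simp add: sum.cartesian_product case_prod_beta)
qed

text \<open>The quadratic form \<open>Tr (b x\<^sup>3)\<close> has polarization \<open>Tr ((b w + b\<^sup>2 w^4) x\<^sup>2)\<close> up to a term free of \<open>x\<close>, so
  only its radical \<open>{0, z}\<close> contributes to the square.\<close>
lemma weil_sum_square_eq:
  assumes z: "b * z ^ 3 = 1"
  shows "(weil_sum a b)\<^sup>2 = 2 ^ m * (1 + chi (a * z + 1))"
proof -
  have chi_shift: "chi (a * x + b * x ^ 3) * chi (a * (x + w) + b * (x + w) ^ 3)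
      = chi (a * w + b * w ^ 3) * chi ((b * w + b\<^sup>2 * w ^ 4) * x\<^sup>2)" for x w
  proof -
    have "(a * x + b * x ^ 3) + (a * (x + w) + b * (x + w) ^ 3)
        = (a * w + b * w ^ 3) + b * w * x\<^sup>2 + b * w\<^sup>2 * x"
      by (simp add: shifted_cube_identity two_eq_zero)
    then have "chi (a * x + b * x ^ 3) * chi (a * (x + w) + b * (x + w) ^ 3)
        = chi (a * w + b * w ^ 3) * chi (b * w * x\<^sup>2) * chi (b * w\<^sup>2 * x)"
      by (simp flip: chi_add)
    \<comment> \<open>Squaring the argument of \<open>chi\<close> changes nothing and turns the term
      linear in x into a multiple of x^2, like its neighbour.\<close>
    also have "chi (b * w\<^sup>2 * x) = chi (b\<^sup>2 * w ^ 4 * x\<^sup>2)"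
      using chi_square[of "b * w\<^sup>2 * x"] by (simp add: power_mult_distrib flip: power_mult)
    finally show ?thesis by (simp add: distrib_right chi_add)
  qed
  have z_nz: "z \<noteq> 0" using z by auto
  have zeros: "b * w + b\<^sup>2 * w ^ 4 = 0 \<longleftrightarrow> w = 0 \<or> w = z" for w
  proof -
    have "b \<noteq> 0" using z by auto
    have "b * w + b\<^sup>2 * w ^ 4 = b * w * (1 + b * w ^ 3)"
      by (simp add: algebra_simps numeral_eq_Suc)
    then have "b * w + b\<^sup>2 * w ^ 4 = 0 \<longleftrightarrow> w = 0 \<or> b * w ^ 3 = b * z ^ 3"
      using \<open>b \<noteq> 0\<close> z by (auto simp: add_eq_zero_iff)
    then show ?thesis using \<open>b \<noteq> 0\<close> by (simp add: cube_eq_iff)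
  qed
  have "(weil_sum a b)\<^sup>2 = (\<Sum>x\<in>UNIV. \<Sum>y\<in>UNIV. chi (a * x + b * x ^ 3) * chi (a * y + b * y ^ 3))"
    unfolding weil_sum_def power2_eq_square sum_product ..
  also have "\<dots> = (\<Sum>x\<in>UNIV. \<Sum>w\<in>UNIV.
      chi (a * x + b * x ^ 3) * chi (a * (x + w) + b * (x + w) ^ 3))"
  proof (rule sum.cong)
    fix x :: 'a
    have "bij ((+) x)" by (rule bij_betw_byWitness[where f' = "\<lambda>y. y - x"]) auto
    then show "(\<Sum>y\<in>UNIV. chi (a * x + b * x ^ 3) * chi (a * y + b * y ^ 3))
        = (\<Sum>w\<in>UNIV. chi (a * x + b * x ^ 3) * chi (a * (x + w) + b * (x + w) ^ 3))"
      by (rule sum.reindex_bij_betw[symmetric])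
  qed simp
  also have "\<dots> = (\<Sum>w\<in>UNIV. chi (a * w + b * w ^ 3) *
      (\<Sum>x\<in>UNIV. chi ((b * w + b\<^sup>2 * w ^ 4) * x\<^sup>2)))"
    unfolding chi_shift by (subst sum.swap) (simp add: sum_distrib_left)
  \<comment> \<open>Squaring permutes the field, so x^2 may be replaced by x and character
    orthogonality applies to the inner sum.\<close>
  also have "\<dots> = (\<Sum>w\<in>UNIV. chi (a * w + b * w ^ 3) *
      (\<Sum>x\<in>UNIV. chi ((b * w + b\<^sup>2 * w ^ 4) * x)))"
    by (intro sum.cong refl arg_cong2[where f = "(*)"]
        sum.reindex_bij_betw[OF bij_square, of "\<lambda>x. chi (_ * x)"])
  also have "\<dots> = (\<Sum>w\<in>UNIV. if w \<in> {0, z} then 2 ^ m * chi (a * w + b * w ^ 3) else 0)"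
    by (intro sum.cong refl) (simp add: sum_chi zeros)
  also have "\<dots> = (\<Sum>w\<in>{0, z}. 2 ^ m * chi (a * w + b * w ^ 3))"
    unfolding sum.If_cases[OF finite] Int_UNIV_left Collect_mem_eq by simp
  also have "\<dots> = 2 ^ m * (1 + chi (a * z + 1))"
    using z z_nz by (simp add: algebra_simps)
  finally show ?thesis .
qed

text \<open>The number s of the overview; the exponent is exactly (m + 1)/2 because m is
  odd.\<close>

definition root_2q :: int where
  "root_2q = 2 ^ ((m + 1) div 2)"

lemma root_2q_square: "root_2q\<^sup>2 = 2 * 2 ^ m"
proof -
  have "(m + 1) div 2 * 2 = m + 1" using odd_m by (auto elim!: oddE)
  then show ?thesis unfolding root_2q_def by (simp flip: power_mult)
qed

lemma root_2q_ge: "root_2q \<ge> 4"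
proof -
  have "(2::int) ^ 2 \<le> 2 ^ ((m + 1) div 2)"
    using m_ge by (intro power_increasing) auto
  then show ?thesis by (simp add: root_2q_def)
qed

lemma root_2q_bound: "root_2q + 2 < 2 ^ m"
proof -
  have "4 * root_2q \<le> root_2q * root_2q"
    using root_2q_ge by (intro mult_right_mono) auto
  then have "4 * root_2q \<le> 2 * 2 ^ m"
    using root_2q_square by (simp add: power2_eq_square)
  then show ?thesis using root_2q_ge by linarith
qed

text \<open>For b = 0 the sum runs over a nontrivial character. Otherwise a cube root z of 1/b
  exists, and the square is 0 or 2 * 2^m according to the sign
  \<open>chi (a * z + 1)\<close>.\<close>

lemma weil_sum_cases:
  assumes "(a, b) \<noteq> (0, 0)"
  shows "weil_sum a b \<in> {0, root_2q, - root_2q}"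
proof (cases "b = 0")
  case True
  then show ?thesis using assms by (simp add: weil_sum_def sum_chi)
next
  case False
  obtain z where "z ^ 3 = 1 / b" using cube_surj by blast
  then have "b * z ^ 3 = 1" using False by simp
  from weil_sum_square_eq[OF this, of a] chi_cases[of "a * z + 1"]
  have "weil_sum a b = 0 \<or> (weil_sum a b)\<^sup>2 = root_2q\<^sup>2"
    by (auto simp: root_2q_square)
  then show ?thesis by (auto simp: power2_eq_iff)
qed

section \<open>Moments of the exponential sums and counts of solutions\<close>

lemma character_moment:
  fixes f g :: "'b \<Rightarrow> 'a"
  assumes "finite P"
  shows "(\<Sum>a\<in>UNIV. \<Sum>b\<in>UNIV. (\<Sum>p\<in>P. chi (a * f p + b * g p)) * chi (a * U + b * V))
    = 2 ^ m * 2 ^ m * int (card {p \<in> P. f p = U \<and> g p = V})"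
proof -
  have "(\<Sum>a\<in>UNIV. \<Sum>b\<in>UNIV. (\<Sum>p\<in>P. chi (a * f p + b * g p)) * chi (a * U + b * V))
      = (\<Sum>a\<in>UNIV. \<Sum>b\<in>UNIV. \<Sum>p\<in>P. chi ((f p + U) * a) * chi ((g p + V) * b))"
    unfolding sum_distrib_right
    by (intro sum.cong refl) (simp add: algebra_simps flip: chi_add)
  also have "\<dots> = (\<Sum>p\<in>P. \<Sum>a\<in>UNIV. \<Sum>b\<in>UNIV. chi ((f p + U) * a) * chi ((g p + V) * b))"
    by (subst sum.swap[of _ P UNIV]) (simp add: sum.swap[of _ P UNIV])
  also have "\<dots> = (\<Sum>p\<in>P. (\<Sum>a\<in>UNIV. chi ((f p + U) * a)) * (\<Sum>b\<in>UNIV. chi ((g p + V) * b)))"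
    by (simp add: sum_product)
  \<comment> \<open>Orthogonality in a and in b; in characteristic 2, f p + U = 0 means f p =
    U.\<close>
  also have "\<dots> = (\<Sum>p\<in>P. if f p = U \<and> g p = V then 2 ^ m * 2 ^ m else 0)"
    by (intro sum.cong refl) (simp add: sum_chi add_eq_zero_iff)
  also have "\<dots> = 2 ^ m * 2 ^ m * int (card {p \<in> P. f p = U \<and> g p = V})"
    using assms by (simp add: sum.If_cases Int_def)
  finally show ?thesis .
qed

definition cube_pairs :: "'a \<Rightarrow> 'a \<Rightarrow> ('a \<times> 'a) set" where
  "cube_pairs U V = {p. fst p + snd p = U \<and> fst p ^ 3 + snd p ^ 3 = V}"

lemma card_cube_pairs_zero: "card (cube_pairs 0 0) \<ge> 2 ^ m"
proof -
  have "card ((\<lambda>x::'a. (x, x)) ` UNIV) \<le> card (cube_pairs 0 0)"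
    by (intro card_mono) (auto simp: cube_pairs_def)
  then show ?thesis by (simp add: card_image inj_on_def card_field)
qed

lemma sum_cubes: "x ^ 3 + y ^ 3 = (x + y) ^ 3 + x * y * (x + (y::'a))"
  by (simp add: sum_cubes_identity two_eq_zero)

text \<open>Since x^3 + y^3 = U^3 + xyU, for nonzero U the sum and product of the pair are fixed,
  hence the pair up to order. If U = 0, solvability forces V = 0, which is excluded.\<close>

lemma card_cube_pairs_le:
  assumes "(U, V) \<noteq> (0, 0)"
  shows "card (cube_pairs U V) \<le> 2"
proof (cases "cube_pairs U V = {}")
  case False
  then obtain x y where xy: "x + y = U" "x ^ 3 + y ^ 3 = V"
    by (auto simp: cube_pairs_def)
  have U: "U \<noteq> 0"
    using assms xy by (auto simp: add_eq_zero_iff)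
  have "p = (x, y) \<or> p = (y, x)" if "p \<in> cube_pairs U V" for p
  proof -
    obtain x' y' where p: "p = (x', y')" by (cases p)
    then have xy': "x' + y' = U" "x' ^ 3 + y' ^ 3 = V"
      using that by (auto simp: cube_pairs_def)
    have "V = U ^ 3 + x * y * U" "V = U ^ 3 + x' * y' * U"
      using sum_cubes[of x y] sum_cubes[of x' y'] xy xy' by simp_all
    then have prods: "x * y = x' * y'" using U by simp
    have "(x' + x) * (x' + y) = x' * x' + x' * U + x * y"
      unfolding xy(1)[symmetric] by (simp add: algebra_simps)
    also have "\<dots> = 2 * (x' * (x' + y'))"
      unfolding prods xy'(1)[symmetric] by (simp add: algebra_simps two_eq_zero)
    finally have "(x' + x) * (x' + y) = 0" by (simp add: two_eq_zero)
    then have "x' = x \<or> x' = y" by (simp add: add_eq_zero_iff)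
    then show ?thesis
      using p xy(1) xy'(1) add_left_cancel[of x y' y] add_left_cancel[of y y' x]
      by (auto simp: add.commute)
  qed
  then have "cube_pairs U V \<subseteq> {(x, y), (y, x)}" by blast
  then have "card (cube_pairs U V) \<le> card {(x, y), (y, x)}" by (intro card_mono) auto
  also have "\<dots> \<le> 2" by (intro card_insert_le_m1) auto
  finally show ?thesis .
qed simp

lemma card_cube_pairs_ge:
  assumes "u \<noteq> t"
  shows "card (cube_pairs (u + t) (u ^ 3 + t ^ 3)) \<ge> 2"
proof -
  have "card {(u, t), (t, u)} \<le> card (cube_pairs (u + t) (u ^ 3 + t ^ 3))"
    by (intro card_mono) (auto simp: cube_pairs_def add.commute)
  then show ?thesis using assms by simp
qed

text \<open>The W^2 part of the moment counts pairs; the s W part counts the x with x = U and x^3 =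
  V, of which there is at most one.\<close>

definition moment_count :: "'a \<Rightarrow> 'a \<Rightarrow> int" where
  "moment_count U V = int (card (cube_pairs U V)) + root_2q * of_bool (V = U ^ 3)"

lemma weil_moment:
  "(\<Sum>a\<in>UNIV. \<Sum>b\<in>UNIV. ((weil_sum a b)\<^sup>2 + root_2q * weil_sum a b) * chi (a * U + b * V))
    = 2 ^ m * 2 ^ m * moment_count U V"
proof -
  have "(\<Sum>a\<in>UNIV. \<Sum>b\<in>UNIV. (weil_sum a b)\<^sup>2 * chi (a * U + b * V))
      = 2 ^ m * 2 ^ m * int (card (cube_pairs U V))"
    unfolding weil_sum_square character_moment[OF finite] cube_pairs_def by simp
  moreover have "(\<Sum>a\<in>UNIV. \<Sum>b\<in>UNIV. weil_sum a b * chi (a * U + b * V))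
      = 2 ^ m * 2 ^ m * int (card {x. x = U \<and> x ^ 3 = V})"
    unfolding weil_sum_def character_moment[OF finite, of "\<lambda>x. x" "\<lambda>x. x ^ 3"] by simp
  moreover have "{x. x = U \<and> x ^ 3 = V} = (if V = U ^ 3 then {U} else {})" by auto
  ultimately show ?thesis
    unfolding distrib_right sum.distrib mult.assoc moment_count_def
    by (simp add: algebra_simps flip: sum_distrib_left)
qed

text \<open>The 2^m diagonal pairs in the first term dominate. If (u, v) = (t, t^3), the last term
  repeats the first, and the total is twice a positive difference.\<close>

lemma moment_count_pos:
  assumes "t \<noteq> 0" "(u, v) \<noteq> (0, 0)"
  shows "moment_count 0 0 - moment_count t (t ^ 3) - moment_count u v
    + moment_count (u + t) (v + t ^ 3) > 0"
proof -
  have zero: "moment_count 0 0 \<ge> 2 ^ m + root_2q"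
    using card_cube_pairs_zero by (simp add: moment_count_def)
  have t: "moment_count t (t ^ 3) \<le> 2 + root_2q"
    using card_cube_pairs_le[of t "t ^ 3"] assms by (simp add: moment_count_def)
  have uv: "int (card (cube_pairs u v)) \<le> 2"
    using card_cube_pairs_le[OF assms(2)] by simp
  note bounds = zero t uv root_2q_bound root_2q_ge
  consider "v = u ^ 3" "u = t" | "v = u ^ 3" "u \<noteq> t" | "v \<noteq> u ^ 3" by blast
  then show ?thesis
  proof cases
    case 1
    then show ?thesis using bounds by simp
  next
    case 2
    \<comment> \<open>The pairs (u, t) and (t, u) are what leaves 2^m - s - 2 as lower bound.
      Without them it would be 2^m - s - 4, which is 0 for m = 3.\<close>
    have "moment_count (u + t) (v + t ^ 3) \<ge> 2"
      using card_cube_pairs_ge[OF 2(2)] 2(1) root_2q_ge by (simp add: moment_count_def)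
    moreover have "moment_count u v \<le> 2 + root_2q" using 2 uv by (simp add: moment_count_def)
    ultimately show ?thesis using bounds by simp
  next
    case 3
    have "moment_count (u + t) (v + t ^ 3) \<ge> 0"
      using root_2q_ge by (simp add: moment_count_def)
    moreover have "moment_count u v \<le> 2" using 3 uv by (simp add: moment_count_def)
    ultimately show ?thesis using bounds by simp
  qed
qed

lemma exists_extremal_weil_sum:
  assumes "t \<noteq> 0" "(u, v) \<noteq> (0, 0)"
  shows "\<exists>a b. weil_sum a b = root_2q \<and> tr (a * t + b * t ^ 3) = 1 \<and> tr (a * u + b * v) = 1"
proof (rule ccontr)
  assume none: "\<not> ?thesis"
  let ?f = "\<lambda>a b. (weil_sum a b)\<^sup>2 + root_2q * weil_sum a b"
  \<comment> \<open>W^2 + s W = W (W + s) kills the values 0 and -s. For W = s the assumption makes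
    a sign factor vanish, and for a = b = 0 both vanish.\<close>
  have "?f a b * ((1 - chi (a * t + b * t ^ 3)) * (1 - chi (a * u + b * v))) = 0" for a b
  proof (cases "weil_sum a b = root_2q \<or> (a, b) = (0, 0)")
    case True
    then have "tr (a * t + b * t ^ 3) = 0 \<or> tr (a * u + b * v) = 0"
      using none by auto
    then show ?thesis by (auto simp: chi_def)
  next
    case False
    then have "?f a b = 0" using weil_sum_cases[of a b] by (auto simp: power2_eq_square)
    then show ?thesis by simp
  qed
  then have "0 = (\<Sum>a\<in>UNIV. \<Sum>b\<in>UNIV.
      ?f a b * ((1 - chi (a * t + b * t ^ 3)) * (1 - chi (a * u + b * v))))"
    by (simp only: sum.neutral_const)
  also have "\<dots> = (\<Sum>a\<in>UNIV. \<Sum>b\<in>UNIV. ?f a b * chi (a * 0 + b * 0)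
      - ?f a b * chi (a * t + b * t ^ 3) - ?f a b * chi (a * u + b * v)
      + ?f a b * chi (a * (u + t) + b * (v + t ^ 3)))"
  proof (intro sum.cong refl)
    fix a b
    have "chi (a * (u + t) + b * (v + t ^ 3)) = chi (a * t + b * t ^ 3) * chi (a * u + b * v)"
      by (simp add: algebra_simps flip: chi_add)
    then show "?f a b * ((1 - chi (a * t + b * t ^ 3)) * (1 - chi (a * u + b * v)))
      = ?f a b * chi (a * 0 + b * 0) - ?f a b * chi (a * t + b * t ^ 3)
        - ?f a b * chi (a * u + b * v) + ?f a b * chi (a * (u + t) + b * (v + t ^ 3))"
      by (simp add: algebra_simps)
  qed
  also have "\<dots> = 2 ^ m * 2 ^ m * (moment_count 0 0 - moment_count t (t ^ 3)
      - moment_count u v + moment_count (u + t) (v + t ^ 3))"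
    unfolding sum.distrib sum_subtractf weil_moment by (simp add: algebra_simps)
  also have "\<dots> > 0"
    using moment_count_pos[OF assms] by simp
  finally show False by simp
qed

section \<open>The dual code as a trace code\<close>

definition len :: nat where
  "len = 2 ^ m - 1"

abbreviation dual :: "bit vec set" where
  "dual \<equiv> dual_code len (bch_code_13 m \<alpha>)"

lemma len_pos: "len > 0"
proof -
  have "(2::nat) ^ 3 \<le> 2 ^ m" using m_ge by (intro power_increasing) auto
  then show ?thesis by (simp add: len_def)
qed

lemma alpha_nonzero: "\<alpha> \<noteq> 0"
proof -
  have "\<alpha> ^ 1 \<in> range (\<lambda>k. \<alpha> ^ k)" by (rule rangeI)
  then show ?thesis using primitive by (simp add: primitive_element_def)
qed

lemma bij_betw_powers: "bij_betw (\<lambda>j. \<alpha> ^ j) {..<len} (UNIV - {0})"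
proof -
  have image: "(\<lambda>j. \<alpha> ^ j) ` {..<len} = UNIV - {0}"
  proof
    show "UNIV - {0} \<subseteq> (\<lambda>j. \<alpha> ^ j) ` {..<len}"
    proof
      fix y :: 'a assume "y \<in> UNIV - {0}"
      then obtain k where "y = \<alpha> ^ k" using primitive by (auto simp: primitive_element_def)
      also have "\<dots> = \<alpha> ^ (len * (k div len) + k mod len)" by simp
      also have "\<dots> = \<alpha> ^ (k mod len)"
        unfolding power_add power_mult power_card_minus_one[OF alpha_nonzero, folded len_def]
        by simp
      finally show "y \<in> (\<lambda>j. \<alpha> ^ j) ` {..<len}"
        using len_pos by (auto intro!: imageI)
    qed
  qed (simp add: image_subset_iff alpha_nonzero)
  have "card (UNIV - {0 :: 'a}) = len"
    by (simp add: card_Diff_singleton card_field len_def)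
  \<comment> \<open>A surjection between finite sets of equal size is injective.\<close>
  then have "inj_on (\<lambda>j. \<alpha> ^ j) {..<len}"
    by (intro eq_card_imp_inj_on) (simp_all add: image)
  then show ?thesis using image by (simp add: bij_betw_def)
qed

definition trace_word :: "'a \<Rightarrow> 'a \<Rightarrow> bit vec" where
  "trace_word a b = vec len (\<lambda>j. tr (a * \<alpha> ^ j + b * (\<alpha> ^ j) ^ 3))"

lemma trace_word_carrier [simp]: "trace_word a b \<in> carrier_vec len"
  by (simp add: trace_word_def)

lemma trace_word_add: "trace_word a b + trace_word c d = trace_word (a + c) (b + d)"
  by (intro eq_vecI) (simp_all add: trace_word_def algebra_simps flip: tr_add)

lemma trace_word_zero: "trace_word 0 0 = 0\<^sub>v len"
  by (intro eq_vecI) (simp_all add: trace_word_def)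

lemma trace_word_weight:
  "2 * int (card {j. j < len \<and> trace_word a b $ j = 1}) = 2 ^ m - weil_sum a b"
proof -
  let ?t = "\<lambda>x. tr (a * x + b * x ^ 3)"
  \<comment> \<open>The element 0 is no code position; its contribution 1 raises \<open>len\<close>
    to 2^m in the result.\<close>
  have "weil_sum a b = 1 + (\<Sum>x\<in>UNIV - {0}. chi (a * x + b * x ^ 3))"
    unfolding weil_sum_def by (subst sum.remove[of UNIV 0]) auto
  also have "(\<Sum>x\<in>UNIV - {0}. chi (a * x + b * x ^ 3))
      = (\<Sum>j<len. chi (a * \<alpha> ^ j + b * (\<alpha> ^ j) ^ 3))"
    by (rule sum.reindex_bij_betw[OF bij_betw_powers, symmetric])
  also have "\<dots> = (\<Sum>j<len. 1 - 2 * of_bool (?t (\<alpha> ^ j) = 1))"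
    by (intro sum.cong refl) (simp add: chi_def bit_sign_def)
  also have "\<dots> = int len - 2 * int (card {j. j < len \<and> ?t (\<alpha> ^ j) = 1})"
    by (simp add: sum_subtractf sum_of_bool_eq Int_def flip: sum_distrib_left)
  also have "{j. j < len \<and> ?t (\<alpha> ^ j) = 1} = {j. j < len \<and> trace_word a b $ j = 1}"
    by (auto simp: trace_word_def)
  finally show ?thesis by (simp add: len_def of_nat_diff)
qed

text \<open>Additivity of \<open>tr\<close> moves it outside the sum and leaves the two syndromes of
  c. This turns every word c into a functional of (a, b).\<close>

lemma scalar_prod_trace_word:
  assumes c: "c \<in> carrier_vec len"
  shows "c \<bullet> trace_word a b = tr (a * code_poly_eval c \<alpha> + b * code_poly_eval c (\<alpha> ^ 3))"
proof -
  have dim: "dim_vec c = len" using c by simp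
  have "a * code_poly_eval c \<alpha> + b * code_poly_eval c (\<alpha> ^ 3)
      = (\<Sum>j<len. of_bool (c $ j = 1) * (a * \<alpha> ^ j + b * (\<alpha> ^ j) ^ 3))"
    unfolding code_poly_eval_def dim sum_distrib_left sum.distrib[symmetric]
    by (intro sum.cong refl) (simp add: algebra_simps flip: power_mult)
  also have "tr \<dots> = (\<Sum>j<len. c $ j * trace_word a b $ j)"
    unfolding tr_sum by (intro sum.cong refl) (auto simp: trace_word_def of_bool_def)
  also have "\<dots> = c \<bullet> trace_word a b"
    by (simp add: scalar_prod_def trace_word_def lessThan_atLeast0)
  finally show ?thesis by simp
qed

lemma mem_bch_code:
  assumes "c \<in> carrier_vec len"
  shows "c \<in> bch_code_13 m \<alpha> \<longleftrightarrow> code_poly_eval c \<alpha> = 0 \<and> code_poly_eval c (\<alpha> ^ 3) = 0"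
  using assms by (auto simp: len_def bch_code_13_def cyclic_code_def)

lemma bch_code_carrier: "bch_code_13 m \<alpha> \<subseteq> carrier_vec len"
  by (auto simp: len_def bch_code_13_def cyclic_code_def)

lemma dual_orthogonal:
  assumes "w \<in> dual" "c \<in> bch_code_13 m \<alpha>"
  shows "c \<bullet> w = 0"
  using assms bch_code_carrier comm_scalar_prod[of c len w] by (auto simp: dual_code_def)

text \<open>A case of Delsarte's theorem on duals of subfield subcodes. A dual word outside the
  trace code would be separated from it by some c; nondegeneracy of the trace puts c into the BCH
  code, a contradiction.\<close>

lemma dual_eq: "dual = {trace_word a b | a b. True}"
proof
  let ?S = "{trace_word a b | a b. True}"
  show "?S \<subseteq> dual"
  proof
    fix w assume "w \<in> ?S"
    then obtain a b where w: "w = trace_word a b" by blast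
    have "w \<bullet> c = 0" if "c \<in> bch_code_13 m \<alpha>" for c
    proof -
      have c: "c \<in> carrier_vec len" using that bch_code_carrier by blast
      then have "c \<bullet> w = 0"
        using that mem_bch_code[OF c] by (simp add: w scalar_prod_trace_word)
      then show ?thesis using c comm_scalar_prod[of c len w] by (simp add: w)
    qed
    then show "w \<in> dual" by (simp add: dual_code_def w)
  qed
  show "dual \<subseteq> ?S"
  proof (rule ccontr)
    assume "\<not> dual \<subseteq> ?S"
    then obtain w where w: "w \<in> dual" "w \<notin> ?S" by blast
    have "\<exists>c\<in>carrier_vec len. (\<forall>s\<in>?S. c \<bullet> s = 0) \<and> c \<bullet> w = 1"
    proof (rule separating_word)
      show "0\<^sub>v len \<in> ?S" using trace_word_zero by (metis (mono_tags) mem_Collect_eq)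
      show "x + y \<in> ?S" if "x \<in> ?S" "y \<in> ?S" for x y
        using that trace_word_add by blast
    qed (use w in \<open>auto simp: dual_code_def\<close>)
    then obtain c where c: "c \<in> carrier_vec len" "\<And>a b. c \<bullet> trace_word a b = 0" "c \<bullet> w = 1"
      by blast
    have "tr (code_poly_eval c \<alpha> * x) = 0" "tr (code_poly_eval c (\<alpha> ^ 3) * x) = 0" for x
      using c(2)[of x 0] c(2)[of 0 x] by (simp_all add: scalar_prod_trace_word[OF c(1)] mult.commute)
    then have "c \<in> bch_code_13 m \<alpha>"
      unfolding mem_bch_code[OF c(1)] using tr_nondegenerate by (metis zero_neq_one)
    then show False using dual_orthogonal[OF w(1)] c(3) by simp
  qed
qed

lemma dual_carrier: "dual \<subseteq> carrier_vec len"
  by (auto simp: dual_code_def)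

lemma dual_add: "x \<in> dual \<Longrightarrow> y \<in> dual \<Longrightarrow> x + y \<in> dual"
  unfolding dual_eq using trace_word_add by blast

lemma zero_in_dual: "0\<^sub>v len \<in> dual"
  unfolding dual_eq using trace_word_zero by (metis (mono_tags) mem_Collect_eq)

section \<open>Minimum distance and connectivity\<close>

lemma hamming_dist_trace_word:
  assumes "x \<in> carrier_vec len" "y \<in> carrier_vec len" "x + y = trace_word a b"
  shows "2 * int (hamming_dist x y) = 2 ^ m - weil_sum a b"
proof -
  have "x $ j \<noteq> y $ j \<longleftrightarrow> trace_word a b $ j = 1" if "j < len" for j
  proof -
    have "trace_word a b $ j = x $ j + y $ j"
      using assms that by (simp flip: assms(3))
    then show ?thesis by (cases "x $ j"; cases "y $ j") simp_all
  qed
  then have "{j. j < dim_vec x \<and> x $ j \<noteq> y $ j} = {j. j < len \<and> trace_word a b $ j = 1}"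
    using assms(1) by auto
  then show ?thesis by (simp add: hamming_dist_def trace_word_weight)
qed

text \<open>Distances are (2^m - W)/2, and s is the largest value of W for distinct
  codewords.\<close>

lemma hamming_dist_eq_min_dist:
  assumes x: "x \<in> dual" and W: "weil_sum a b = root_2q"
  shows "hamming_dist x (x + trace_word a b) = min_dist dual"
proof -
  let ?y = "x + trace_word a b"
  have carrier: "x \<in> carrier_vec len" "?y \<in> carrier_vec len"
    using x dual_carrier by auto
  have y: "?y \<in> dual" using x by (intro dual_add) (auto simp: dual_eq)
  have "x + ?y = trace_word a b"
    using carrier(1) bit_vec_add_cancel[of "trace_word a b" len x]
    by (metis add_carrier_vec comm_add_vec trace_word_carrier)
  then have dist: "2 * int (hamming_dist x ?y) = 2 ^ m - root_2q"
    using hamming_dist_trace_word[OF carrier] W by simp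
  have "hamming_dist x x = 0" by (simp add: hamming_dist_def)
  then have neq: "x \<noteq> ?y"
    using dist root_2q_bound by auto
  have "hamming_dist x ?y \<le> hamming_dist u v" if uv: "u \<in> dual" "v \<in> dual" "u \<noteq> v" for u v
  proof -
    obtain c d where cd: "u + v = trace_word c d"
      using dual_add[OF uv(1,2)] unfolding dual_eq by blast
    have carr: "u \<in> carrier_vec len" "v \<in> carrier_vec len" using uv dual_carrier by auto
    have "(c, d) \<noteq> (0, 0)"
    proof
      assume "(c, d) = (0, 0)"
      then have "u + v = 0\<^sub>v len" using cd trace_word_zero by simp
      then show False
        using bit_vec_add_cancel[OF carr] uv(3) carr by (metis left_zero_vec)
    qed
    from weil_sum_cases[OF this] have "weil_sum c d \<le> root_2q"
      using root_2q_ge by auto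
    then show ?thesis using hamming_dist_trace_word[OF carr cd] dist by simp
  qed
  then show ?thesis
    unfolding min_dist_def using x y neq by (intro cInf_eq_minimum[symmetric]) blast+
qed

lemma i_graph_reachable:
  assumes i: "i < len" and x: "x \<in> dual" and w: "w \<in> dual"
  shows "x \<rightarrow>\<^sup>*\<^bsub>with_proj (i_graph dual i)\<^esub> (x + w)"
proof -
  let ?G = "with_proj (i_graph dual i)"
  interpret wf_digraph ?G
    by unfold_locales (auto simp: i_graph_def)
  have verts: "verts ?G = dual" by (simp add: i_graph_def)
  \<comment> \<open>Requiring the path from every start x lets paths be concatenated, so
    \<open>S\<close> is closed under addition and \<open>separating_word\<close> applies.\<close>
  define S where "S = {w \<in> dual. \<forall>x\<in>dual. x \<rightarrow>\<^sup>*\<^bsub>?G\<^esub> (x + w)}"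
  have "w \<in> S"
  proof (rule ccontr)
    assume "w \<notin> S"
    have "\<exists>c\<in>carrier_vec len. (\<forall>s\<in>S. c \<bullet> s = 0) \<and> c \<bullet> w = 1"
    proof (rule separating_word)
      show "S \<subseteq> carrier_vec len" using dual_carrier by (auto simp: S_def)
      have "x + 0\<^sub>v len = x" if "x \<in> dual" for x using that dual_carrier by auto
      then show "0\<^sub>v len \<in> S"
        using zero_in_dual verts by (simp add: S_def)
      fix s t assume st: "s \<in> S" "t \<in> S"
      have "x \<rightarrow>\<^sup>*\<^bsub>?G\<^esub> (x + (s + t))" if x: "x \<in> dual" for x
      proof -
        have "x \<rightarrow>\<^sup>*\<^bsub>?G\<^esub> (x + s)" "(x + s) \<rightarrow>\<^sup>*\<^bsub>?G\<^esub> (x + s + t)"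
          using st x dual_add by (auto simp: S_def)
        moreover have "x + s + t = x + (s + t)"
          using st x dual_carrier by (intro assoc_add_vec) (auto simp: S_def)
        ultimately show ?thesis by (metis reachable_trans)
      qed
      then show "s + t \<in> S" using st dual_add by (auto simp: S_def)
    qed (use w \<open>w \<notin> S\<close> dual_carrier in auto)
    then obtain c where c: "c \<in> carrier_vec len" "\<And>s. s \<in> S \<Longrightarrow> c \<bullet> s = 0" "c \<bullet> w = 1"
      by blast
    let ?u = "code_poly_eval c \<alpha>" and ?v = "code_poly_eval c (\<alpha> ^ 3)"
    \<comment> \<open>Since c is not orthogonal to the dual word w, its syndromes are not both zero
      and can serve as u and v in \<open>exists_extremal_weil_sum\<close>.\<close>
    have "c \<notin> bch_code_13 m \<alpha>" using dual_orthogonal[OF w] c(3) by auto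
    then have "(?u, ?v) \<noteq> (0, 0)" using mem_bch_code[OF c(1)] by simp
    then obtain a b where ab: "weil_sum a b = root_2q"
        "tr (a * \<alpha> ^ i + b * (\<alpha> ^ i) ^ 3) = 1" "tr (a * ?u + b * ?v) = 1"
      using exists_extremal_weil_sum[of "\<alpha> ^ i" ?u ?v] alpha_nonzero by auto
    let ?g = "trace_word a b"
    have g: "?g \<in> dual" by (auto simp: dual_eq)
    \<comment> \<open>Adding \<open>?g\<close> is a single edge: it has minimum weight and flips
      position i. So \<open>?g\<close> lies in \<open>S\<close>, although c does not annihilate
      it.\<close>
    have "x \<rightarrow>\<^sup>*\<^bsub>?G\<^esub> (x + ?g)" if x: "x \<in> dual" for x
    proof (rule reachable_adjI)
      have "(x + ?g) $ i = x $ i + 1"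
        using i ab(2) by (simp add: trace_word_def)
      then have "x $ i \<noteq> (x + ?g) $ i" by (cases "x $ i") simp_all
      then show "x \<rightarrow>\<^bsub>?G\<^esub> (x + ?g)"
        using x dual_add[OF x g] hamming_dist_eq_min_dist[OF x ab(1)]
        by (auto simp: i_graph_def arcs_ends_def arc_to_ends_def)
    qed
    then have "c \<bullet> ?g = 0" using g c(2) by (auto simp: S_def)
    then show False using ab(3) scalar_prod_trace_word[OF c(1)] by simp
  qed
  then show ?thesis using x by (simp add: S_def)
qed

end

theorem theorem4:
  fixes \<alpha> :: "'a::{field,finite}" and m i :: nat
  assumes "m \<ge> 3" and "odd m"
    and "CARD('a) = 2 ^ m"
    and "primitive_element \<alpha>"
    and "i < 2 ^ m - 1"
  shows "i_components (dual_code (2 ^ m - 1) (bch_code_13 m \<alpha>)) i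
       = {dual_code (2 ^ m - 1) (bch_code_13 m \<alpha>)}"
proof -
  interpret binary_bch \<alpha> m
    using assms by unfold_locales auto
  let ?G = "with_proj (i_graph dual i)"
  have i: "i < len" using assms(5) by (simp add: len_def)
  have verts: "verts ?G = dual" by (simp add: i_graph_def)
  have reach: "u \<rightarrow>\<^sup>*\<^bsub>?G\<^esub> v" if uv: "u \<in> dual" "v \<in> dual" for u v
  proof -
    \<comment> \<open>The word v + u is the translation that carries u to v.\<close>
    have "u + (v + u) = v"
      using bit_vec_add_cancel[of v len u] uv dual_carrier
      by (metis add_carrier_vec comm_add_vec subsetD)
    then show ?thesis using i_graph_reachable[OF i uv(1) dual_add[OF uv(2,1)]] by simp
  qed
  interpret wf_digraph ?G
    by unfold_locales (auto simp: i_graph_def)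
  have in_dual: "u \<in> dual" if "u \<rightarrow>\<^sup>*\<^bsub>?G\<^esub> v" for u v
    using that verts reachable_in_verts(1) by auto
  have "S = dual" if "S \<in> pre_digraph.sccs_verts ?G" for S
    using that reach in_dual unfolding in_sccs_verts_conv_reachable by blast
  moreover have "dual \<in> pre_digraph.sccs_verts ?G"
    using reach in_dual zero_in_dual unfolding in_sccs_verts_conv_reachable by blast
  ultimately show ?thesis unfolding i_components_def len_def[symmetric] by blast
qed

end
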